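(* Let $a\in\{1,2,3\}$ and let $p$ be the partially ordered pattern of length $3$ whose poset on $\{1,2,3\}$ has relations exactly $j<a$ for the two elements $j\ne a$ (the two other elements incomparable). Let $q$ be the partially ordered pattern of length $3$ whose poset has relations exactly $2<1$ and $2<3$ (so avoiding $q$ is the same as avoiding both classical patterns $213$ and $312$). Then $p$ and $q$ are shape-Wilf-equivalent.
   Context: A partially ordered pattern (POP) $p$ of length $k$ is a partial order $P$ on $\{1,\dots,k\}$. An occurrence of $p$ in a permutation $\pi_1\cdots\pi_n$ is a subsequence $\pi_{i_1}\cdots\pi_{i_k}$ ($i_1<\dots<i_k$) such that $\pi_{i_j}<\pi_{i_m}$ whenever $j<m$ in $P$. Equivalently, avoiding $p$ means avoiding every classical pattern $r\in S_k$ with $r_j<r_m$ whenever $j<_P m$; avoidance of a POP in a filling means avoidance of all these classical patterns. A Ferrers board is a finite bottom-left-justified array of unit squares in which the number of squares in each row is at most the number in the row below (a set $F$ of cells $(i,j)$, column $i$, row $j$, closed under decreasing either coordinate). A filling of $F$ assigns $0$'s and $1$'s to its cells so that every row and every column of $F$ has exactly one $1$. A filling contains a classical pattern $r$ of length $k$ if there are columns $c_1<\dots<c_k$ and rows $r'_1<\dots<r'_k$ with all cells $(c_a,r'_b)$ in $F$ such that the filling restricted to these cells has a $1$ at $(c_a,r'_b)$ exactly when $r_a=b$. Two (sets of) patterns are shape-Wilf-equivalent if for every Ferrers board $F$ the numbers of fillings of $F$ avoiding them are equal. *)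

theory Defs
  imports "HOL-Combinatorics.Permutations" "HOL-Library.FuncSet"
begin

text \<open>Cells are pairs (column, row), both numbered from 1.\<close>

definition ferrers_board :: "(nat \<times> nat) set \<Rightarrow> bool" where
  "ferrers_board F \<longleftrightarrow>
     finite F \<and>
     (\<forall>(i, j) \<in> F. 1 \<le> i \<and> 1 \<le> j \<and>
        (\<forall>i' j'. 1 \<le> i' \<and> i' \<le> i \<and> 1 \<le> j' \<and> j' \<le> j \<longrightarrow> (i', j') \<in> F))"

text \<open>Fillings are extensional functions, so that counting them counts assignments to the
  cells of \<open>F\<close> only. Only nonempty rows and columns are rows and columns of \<open>F\<close>.\<close>

definition fillings :: "(nat \<times> nat) set \<Rightarrow> (nat \<times> nat \<Rightarrow> nat) set" where
  "fillings F =
     {f \<in> F \<rightarrow>\<^sub>E {0, 1}.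
        (\<forall>i \<in> fst ` F. \<exists>!j. (i, j) \<in> F \<and> f (i, j) = 1) \<and>
        (\<forall>j \<in> snd ` F. \<exists>!i. (i, j) \<in> F \<and> f (i, j) = 1)}"

text \<open>A pattern \<open>(k, r)\<close> is a length together with a permutation \<open>r\<close> of \<open>{1..k}\<close>.\<close>

type_synonym pattern = "nat \<times> (nat \<Rightarrow> nat)"

definition contains_pattern ::
    "(nat \<times> nat) set \<Rightarrow> (nat \<times> nat \<Rightarrow> nat) \<Rightarrow> pattern \<Rightarrow> bool" where
  "contains_pattern F f = (\<lambda>(k, r).
     \<exists>c \<rho> :: nat \<Rightarrow> nat.
       strict_mono_on {1..k} c \<and> strict_mono_on {1..k} \<rho> \<and>
       (\<forall>x \<in> {1..k}. \<forall>y \<in> {1..k}.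
          (c x, \<rho> y) \<in> F \<and> (f (c x, \<rho> y) = 1 \<longleftrightarrow> r x = y)))"

definition avoiding_fillings ::
    "(nat \<times> nat) set \<Rightarrow> pattern set \<Rightarrow> (nat \<times> nat \<Rightarrow> nat) set" where
  "avoiding_fillings F R = {f \<in> fillings F. \<forall>p \<in> R. \<not> contains_pattern F f p}"

definition shape_Wilf_equivalent :: "pattern set \<Rightarrow> pattern set \<Rightarrow> bool" where
  "shape_Wilf_equivalent R S \<longleftrightarrow>
     (\<forall>F. ferrers_board F \<longrightarrow> card (avoiding_fillings F R) = card (avoiding_fillings F S))"

text \<open>A partially ordered pattern of length \<open>k\<close> is a (reflexive) partial order \<open>P\<close> on
  \<open>{1..k}\<close>, the pair \<open>(j, m) \<in> P\<close> meaning \<open>j \<le> m\<close> in the order.\<close>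

abbreviation is_pop :: "nat \<Rightarrow> nat rel \<Rightarrow> bool" where
  "is_pop k P \<equiv> partial_order_on {1..k} P"

definition pop_patterns :: "nat \<Rightarrow> nat rel \<Rightarrow> pattern set" where
  "pop_patterns k P =
     {(k, r) | r. r permutes {1..k} \<and> (\<forall>j m. (j, m) \<in> P \<and> j \<noteq> m \<longrightarrow> r j < r m)}"

definition pop_shape_Wilf_equivalent :: "nat \<Rightarrow> nat rel \<Rightarrow> nat \<Rightarrow> nat rel \<Rightarrow> bool" where
  "pop_shape_Wilf_equivalent k P l Q \<longleftrightarrow>
     shape_Wilf_equivalent (pop_patterns k P) (pop_patterns l Q)"

definition pop_top :: "nat \<Rightarrow> nat rel" where
  "pop_top a = Id_on {1..3} \<union> {(j, a) | j. j \<in> {1..3} \<and> j \<noteq> a}"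

definition pop_V :: "nat rel" where
  "pop_V = Id_on {1..3} \<union> {(2, 1), (2, 3)}"

lemma is_pop_top: "a \<in> {1, 2, 3} \<Longrightarrow> is_pop 3 (pop_top a)"
  by (auto simp: pop_top_def partial_order_on_def preorder_on_def refl_on_def trans_def antisym_def)

lemma is_pop_V: "is_pop 3 pop_V"
  by (auto simp: pop_V_def partial_order_on_def preorder_on_def refl_on_def trans_def antisym_def)

lemma finite_fillings: "finite F \<Longrightarrow> finite (fillings F)"
  unfolding fillings_def by (rule finite_subset[OF _ finite_PiE[of F "\<lambda>_. {0, 1}"]]) auto

end

theory Submission
  imports Defs
begin

text \<open>A filling of a Ferrers board assigns to each row \<open>j\<close> the column \<open>\<sigma> j\<close> of its \<open>1\<close>.
  Deleting the top row together with the column \<open>c\<close> of its \<open>1\<close> leaves a Ferrers board that does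
  not depend on \<open>c\<close>. For each of the four pattern sets, a smaller avoiding filling extends in
  exactly \<open>min 2 m\<close> ways, where \<open>m\<close> is the length of the top row: for the pattern with top
  element \<open>a\<close>, the first \<open>m\<close> columns may not contain two further \<open>1\<close>s in forbidden position
  relative to \<open>c\<close>; for \<open>q\<close>, the first \<open>m\<close> columns must form a unimodal word, so the new maximum
  has to be inserted directly to the left or right of the old one. Hence all the counts satisfy
  the same recursion.\<close>

section \<open>Inserting a top row together with the column of its 1\<close>

text \<open>The increasing enumeration of the naturals other than \<open>c\<close>: it renumbers the
  old columns when a new one is inserted at position \<open>c\<close>.\<close>

definition shift :: "nat \<Rightarrow> nat \<Rightarrow> nat" where
  "shift c x = (if x < c then x else Suc x)"

lemma strict_mono_shift: "strict_mono (shift c)"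
  by (auto simp: strict_mono_def shift_def)

lemma shift_eq_iff [simp]: "shift c x = shift c y \<longleftrightarrow> x = y"
  by (auto simp: shift_def split: if_splits)

lemma shift_neq [simp]: "shift c x \<noteq> c" "c \<noteq> shift c x"
  by (auto simp: shift_def)

lemma shift_le_iff:
  assumes "1 \<le> c" "c \<le> m"
  shows "shift c x \<le> m \<longleftrightarrow> x \<le> m - 1"
  using assms by (auto simp: shift_def)

lemma one_le_shift_iff:
  assumes "1 \<le> c"
  shows "1 \<le> shift c x \<longleftrightarrow> 1 \<le> x"
  using assms by (auto simp: shift_def)

lemma shift_surj:
  assumes "x \<noteq> c"
  obtains y where "x = shift c y"
proof
  show "x = shift c (if x < c then x else x - 1)"
    using assms by (auto simp: shift_def)
qed

text \<open>\<open>B x y z\<close> says that columns \<open>x, y, z\<close> of the \<open>1\<close>s in three rows, listed from bottom to top,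
  form a forbidden pattern. By the shape of the board, a \<open>3 \<times> 3\<close> subboard lies inside it as soon
  as its top row reaches all three columns.\<close>

definition placements :: "(nat \<Rightarrow> nat \<Rightarrow> nat \<Rightarrow> bool) \<Rightarrow> nat \<Rightarrow> (nat \<Rightarrow> nat) \<Rightarrow> (nat \<Rightarrow> nat) set" where
  "placements B n l = {\<sigma> \<in> (\<Pi>\<^sub>E j\<in>{1..n}. {1..l j}). inj_on \<sigma> {1..n} \<and>
     (\<forall>r1 r2 r3. 1 \<le> r1 \<and> r1 < r2 \<and> r2 < r3 \<and> r3 \<le> n \<and> \<sigma> r1 \<le> l r3 \<and> \<sigma> r2 \<le> l r3 \<longrightarrow>
        \<not> B (\<sigma> r1) (\<sigma> r2) (\<sigma> r3))}"

text \<open>The argument is a pair so that the map is defined on a dependent sum of smaller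
  placements and columns for the new 1. The outer update keeps the result extensional on
  \<open>{1..Suc n}\<close>.\<close>

definition add_row :: "nat \<Rightarrow> (nat \<Rightarrow> nat) \<times> nat \<Rightarrow> nat \<Rightarrow> nat" where
  "add_row n = (\<lambda>(\<tau>, c). (\<lambda>j\<in>{1..n}. shift c (\<tau> j))(Suc n := c))"

text \<open>The columns in which a new top row of length \<open>m\<close> may have its \<open>1\<close>.\<close>

definition insertions :: "(nat \<Rightarrow> nat \<Rightarrow> nat \<Rightarrow> bool) \<Rightarrow> nat \<Rightarrow> nat \<Rightarrow> (nat \<Rightarrow> nat) \<Rightarrow> nat set" where
  "insertions B n m \<tau> = {c \<in> {1..m}. \<forall>r1 r2. 1 \<le> r1 \<and> r1 < r2 \<and> r2 \<le> n \<and>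
      shift c (\<tau> r1) \<le> m \<and> shift c (\<tau> r2) \<le> m \<longrightarrow> \<not> B (shift c (\<tau> r1)) (shift c (\<tau> r2)) c}"

text \<open>Allows \<open>shift c\<close> to be cancelled: three old rows keep their status when a
  column is inserted.\<close>

definition order_invariant :: "(nat \<Rightarrow> nat \<Rightarrow> nat \<Rightarrow> bool) \<Rightarrow> bool" where
  "order_invariant B \<longleftrightarrow> (\<forall>s x y z. strict_mono s \<longrightarrow> B (s x) (s y) (s z) = B x y z)"

lemma add_row_top [simp]: "add_row n (\<tau>, c) (Suc n) = c"
  by (simp add: add_row_def)

lemma add_row_below: "1 \<le> j \<Longrightarrow> j \<le> n \<Longrightarrow> add_row n (\<tau>, c) j = shift c (\<tau> j)"
  by (simp add: add_row_def)

lemma add_row_outside: "j \<notin> {1..Suc n} \<Longrightarrow> add_row n (\<tau>, c) j = undefined"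
  by (auto simp: add_row_def)

lemma finite_placements: "finite (placements B n l)"
  unfolding placements_def
  by (rule finite_subset[of _ "\<Pi>\<^sub>E j\<in>{1..n}. {1..l j}"]) (auto intro: finite_PiE)

text \<open>The top row is the shortest, so column \<open>c\<close> meets every row, and deleting it
  shortens each row by exactly one, whichever \<open>c\<close> is chosen. Triples of old rows are
  unaffected by order invariance; triples involving the new row are those that
  \<open>insertions\<close> controls.\<close>

lemma add_row_in_placements_iff:
  assumes B: "order_invariant B" and anti: "antimono_on {1..Suc n} l"
    and ext: "\<tau> \<in> extensional {1..n}" and c: "c \<in> {1..l (Suc n)}"
  shows "add_row n (\<tau>, c) \<in> placements B (Suc n) l \<longleftrightarrow>
    \<tau> \<in> placements B n (\<lambda>j. l j - 1) \<and> c \<in> insertions B n (l (Suc n)) \<tau>"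
proof -
  let ?\<sigma> = "add_row n (\<tau>, c)"
  have cl: "c \<le> l j" if "1 \<le> j" "j \<le> Suc n" for j
    using monotone_onD[OF anti, of j "Suc n"] that c by auto
  have le: "shift c x \<le> l j \<longleftrightarrow> x \<le> l j - 1" if "1 \<le> j" "j \<le> Suc n" for x j
    using shift_le_iff[of c "l j" x] cl[OF that] c by simp
  have inv: "B (shift c x) (shift c y) (shift c z) = B x y z" for x y z
    using B strict_mono_shift[of c] unfolding order_invariant_def by blast
  have range: "?\<sigma> \<in> (\<Pi>\<^sub>E j\<in>{1..Suc n}. {1..l j}) \<longleftrightarrow> \<tau> \<in> (\<Pi>\<^sub>E j\<in>{1..n}. {1..l j - 1})"
  proof -
    have "?\<sigma> \<in> (\<Pi>\<^sub>E j\<in>{1..Suc n}. {1..l j}) \<longleftrightarrow> (\<forall>j\<in>{1..n}. ?\<sigma> j \<in> {1..l j})"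
    proof -
      have "?\<sigma> \<in> extensional {1..Suc n}"
        by (auto simp: extensional_def add_row_outside)
      moreover have "{1..Suc n} = insert (Suc n) {1..n}" by auto
      ultimately show ?thesis using c by (auto simp: PiE_def Pi_def)
    qed
    also have "\<dots> \<longleftrightarrow> (\<forall>j\<in>{1..n}. \<tau> j \<in> {1..l j - 1})"
      using c le by (intro ball_cong refl) (simp add: add_row_below one_le_shift_iff[simplified])
    also have "\<dots> \<longleftrightarrow> \<tau> \<in> (\<Pi>\<^sub>E j\<in>{1..n}. {1..l j - 1})"
      using ext by (auto simp: PiE_def Pi_def)
    finally show ?thesis .
  qed
  have inj: "inj_on ?\<sigma> {1..Suc n} \<longleftrightarrow> inj_on \<tau> {1..n}"
  proof -
    have "{1..Suc n} = insert (Suc n) {1..n}" by auto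
    moreover have "c \<notin> ?\<sigma> ` ({1..n} - {Suc n})"
      by (auto simp: add_row_below)
    moreover have "inj_on ?\<sigma> {1..n} \<longleftrightarrow> inj_on \<tau> {1..n}"
      by (auto simp: inj_on_def add_row_below)
    ultimately show ?thesis by simp
  qed
  have avoid: "(\<forall>r1 r2 r3. 1 \<le> r1 \<and> r1 < r2 \<and> r2 < r3 \<and> r3 \<le> Suc n \<and> ?\<sigma> r1 \<le> l r3 \<and> ?\<sigma> r2 \<le> l r3 \<longrightarrow>
        \<not> B (?\<sigma> r1) (?\<sigma> r2) (?\<sigma> r3)) \<longleftrightarrow>
      (\<forall>r1 r2 r3. 1 \<le> r1 \<and> r1 < r2 \<and> r2 < r3 \<and> r3 \<le> n \<and> \<tau> r1 \<le> l r3 - 1 \<and> \<tau> r2 \<le> l r3 - 1 \<longrightarrow>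
        \<not> B (\<tau> r1) (\<tau> r2) (\<tau> r3)) \<and>
      (\<forall>r1 r2. 1 \<le> r1 \<and> r1 < r2 \<and> r2 \<le> n \<and> shift c (\<tau> r1) \<le> l (Suc n) \<and> shift c (\<tau> r2) \<le> l (Suc n)
        \<longrightarrow> \<not> B (shift c (\<tau> r1)) (shift c (\<tau> r2)) c)" (is "?L \<longleftrightarrow> ?R1 \<and> ?R2")
  proof (intro iffI conjI allI impI)
    fix r1 r2 r3 assume L: ?L
      and "1 \<le> r1 \<and> r1 < r2 \<and> r2 < r3 \<and> r3 \<le> n \<and> \<tau> r1 \<le> l r3 - 1 \<and> \<tau> r2 \<le> l r3 - 1"
    then show "\<not> B (\<tau> r1) (\<tau> r2) (\<tau> r3)"
      using L[rule_format, of r1 r2 r3] le[of r3] by (simp add: add_row_below inv)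
  next
    fix r1 r2 assume L: ?L
      and "1 \<le> r1 \<and> r1 < r2 \<and> r2 \<le> n \<and> shift c (\<tau> r1) \<le> l (Suc n) \<and> shift c (\<tau> r2) \<le> l (Suc n)"
    then show "\<not> B (shift c (\<tau> r1)) (shift c (\<tau> r2)) c"
      using L[rule_format, of r1 r2 "Suc n"] by (simp add: add_row_below)
  next
    fix r1 r2 r3 assume R: "?R1 \<and> ?R2"
      and r: "1 \<le> r1 \<and> r1 < r2 \<and> r2 < r3 \<and> r3 \<le> Suc n \<and> ?\<sigma> r1 \<le> l r3 \<and> ?\<sigma> r2 \<le> l r3"
    show "\<not> B (?\<sigma> r1) (?\<sigma> r2) (?\<sigma> r3)"
    \<comment> \<open>The new row is the highest, so it can only be the third row of a
      triple.\<close>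
    proof (cases "r3 = Suc n")
      case True
      then show ?thesis using r conjunct2[OF R, rule_format, of r1 r2] by (auto simp: add_row_below)
    next
      case False
      then have r3: "1 \<le> r3" "r3 \<le> n" using r by auto
      then have \<sigma>: "?\<sigma> r1 = shift c (\<tau> r1)" "?\<sigma> r2 = shift c (\<tau> r2)" "?\<sigma> r3 = shift c (\<tau> r3)"
        using r by (auto intro!: add_row_below)
      have "\<tau> r1 \<le> l r3 - 1" "\<tau> r2 \<le> l r3 - 1" using r r3 le[of r3] unfolding \<sigma> by simp_all
      then show ?thesis
        unfolding \<sigma> inv using r r3 conjunct1[OF R, rule_format, of r1 r2 r3] by blast
    qed
  qed
  show ?thesis
    by (simp only: placements_def insertions_def mem_Collect_eq range inj avoid c conj_assoc simp_thms)
qed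

text \<open>\<open>add_row\<close> is a bijection from the pairs of a smaller placement and an
  admissible column, and each smaller placement has \<open>k\<close> admissible columns.\<close>

lemma card_placements_Suc:
  assumes B: "order_invariant B" and anti: "antimono_on {1..Suc n} l"
    and ins: "\<And>\<tau>. \<tau> \<in> placements B n (\<lambda>j. l j - 1) \<Longrightarrow> card (insertions B n (l (Suc n)) \<tau>) = k"
  shows "card (placements B (Suc n) l) = card (placements B n (\<lambda>j. l j - 1)) * k"
proof -
  let ?P = "placements B n (\<lambda>j. l j - 1)"
  let ?S = "SIGMA \<tau>:?P. insertions B n (l (Suc n)) \<tau>"
  have ext: "\<tau> \<in> extensional {1..n}" if "\<tau> \<in> ?P" for \<tau>
    using that by (auto simp: placements_def PiE_def)
  have "bij_betw (add_row n) ?S (placements B (Suc n) l)"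
  proof (rule bij_betw_imageI)
    show "inj_on (add_row n) ?S"
    proof (rule inj_onI, clarify)
      fix \<tau> c \<tau>' c'
      assume \<tau>: "\<tau> \<in> ?P" "\<tau>' \<in> ?P" and eq: "add_row n (\<tau>, c) = add_row n (\<tau>', c')"
      have c: "c = c'" using fun_cong[OF eq, of "Suc n"] by simp
      have "\<tau> = \<tau>'"
      proof (rule extensionalityI[OF ext[OF \<tau>(1)] ext[OF \<tau>(2)]])
        fix j assume "j \<in> {1..n}"
        then show "\<tau> j = \<tau>' j" using fun_cong[OF eq, of j] c by (simp add: add_row_below)
      qed
      then show "\<tau> = \<tau>' \<and> c = c'" using c by simp
    qed
    show "add_row n ` ?S = placements B (Suc n) l"
    proof (intro equalityI subsetI)
      fix \<sigma> assume "\<sigma> \<in> add_row n ` ?S"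
      then obtain \<tau> c where "\<tau> \<in> ?P" "c \<in> insertions B n (l (Suc n)) \<tau>" "\<sigma> = add_row n (\<tau>, c)"
        by auto
      then show "\<sigma> \<in> placements B (Suc n) l"
        using add_row_in_placements_iff[OF B anti ext, of \<tau> c] by (auto simp: insertions_def)
    next
      fix \<sigma> assume \<sigma>: "\<sigma> \<in> placements B (Suc n) l"
      define c where "c = \<sigma> (Suc n)"
      have c: "c \<in> {1..l (Suc n)}"
        using \<sigma> unfolding placements_def c_def by (auto dest: PiE_mem)
      have inj: "inj_on \<sigma> {1..Suc n}" and e: "\<sigma> \<in> extensional {1..Suc n}"
        using \<sigma> by (auto simp: placements_def PiE_def)
      \<comment> \<open>By injectivity no lower row has its 1 in column \<open>c\<close>, so all the
        other columns lie in the range of \<open>shift c\<close> and column \<open>c\<close> can be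
        deleted.\<close>
      have "\<exists>y. \<sigma> j = shift c y" if "j \<in> {1..n}" for j
      proof -
        have "\<sigma> j \<noteq> c" using inj_onD[OF inj, of j "Suc n"] that by (auto simp: c_def)
        then show ?thesis by (rule shift_surj) auto
      qed
      then obtain t where t: "\<And>j. j \<in> {1..n} \<Longrightarrow> \<sigma> j = shift c (t j)" by metis
      let ?\<tau> = "restrict t {1..n}"
      have eq: "add_row n (?\<tau>, c) = \<sigma>"
      proof
        fix j
        consider "j = Suc n" | "j \<in> {1..n}" | "j \<notin> {1..Suc n}"
          by (meson atLeastAtMost_iff le_SucE)
        then show "add_row n (?\<tau>, c) j = \<sigma> j"
        proof cases
          case 3
          show ?thesis unfolding add_row_outside[OF 3] extensional_arb[OF e 3] by (rule refl)
        qed (auto simp: c_def[symmetric] add_row_below t)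
      qed
      have "(?\<tau>, c) \<in> ?S"
        using add_row_in_placements_iff[OF B anti restrict_extensional c, of t] \<sigma> eq by simp
      then show "\<sigma> \<in> add_row n ` ?S" using eq by (metis imageI)
    qed
  qed
  then have "card (placements B (Suc n) l) = card ?S" by (simp add: bij_betw_same_card)
  also have "\<dots> = (\<Sum>\<tau>\<in>?P. card (insertions B n (l (Suc n)) \<tau>))"
    by (intro card_SigmaI) (auto simp: finite_placements insertions_def)
  also have "\<dots> = card ?P * k" using ins by simp
  finally show ?thesis .
qed

section \<open>The common recursion\<close>

text \<open>The bound \<open>Suc n\<close> leaves rows of length at most \<open>n\<close> in the
  smaller board, so that its \<open>n\<close> 1s occupy all the columns from 1 to
  \<open>n\<close>.\<close>

definition two_insertions :: "(nat \<Rightarrow> nat \<Rightarrow> nat \<Rightarrow> bool) \<Rightarrow> bool" where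
  "two_insertions B \<longleftrightarrow> (\<forall>n l \<tau>. antimono_on {1..Suc n} l \<and> (\<forall>j\<in>{1..Suc n}. l j \<le> Suc n) \<and>
     \<tau> \<in> placements B n (\<lambda>j. l j - 1) \<longrightarrow> card (insertions B n (l (Suc n)) \<tau>) = min 2 (l (Suc n)))"

text \<open>By induction both counts acquire the same factor with each new top row. Row lengths may
  be zero here, because the recursion lowers them by truncated subtraction.\<close>

lemma card_placements_eq:
  assumes "order_invariant B" "two_insertions B" "order_invariant B'" "two_insertions B'"
    and "antimono_on {1..n} l" "\<forall>j\<in>{1..n}. l j \<le> n"
  shows "card (placements B n l) = card (placements B' n l)"
  using assms(5,6)
proof (induction n arbitrary: l)
  case 0
  show ?case by (simp add: placements_def)
next
  case (Suc n)
  let ?l = "\<lambda>j. l j - 1"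
  have "antimono_on {1..n} ?l"
    using Suc.prems(1) by (auto simp: monotone_on_def intro!: diff_le_mono)
  moreover have "\<forall>j\<in>{1..n}. ?l j \<le> n" using Suc.prems(2) by (auto simp: le_diff_conv)
  ultimately have IH: "card (placements B n ?l) = card (placements B' n ?l)" by (rule Suc.IH)
  have "card (placements B (Suc n) l) = card (placements B n ?l) * min 2 (l (Suc n))"
    using assms(2) Suc.prems unfolding two_insertions_def
    by (intro card_placements_Suc[OF assms(1) Suc.prems(1)]) blast
  moreover have "card (placements B' (Suc n) l) = card (placements B' n ?l) * min 2 (l (Suc n))"
    using assms(4) Suc.prems unfolding two_insertions_def
    by (intro card_placements_Suc[OF assms(3) Suc.prems(1)]) blast
  ultimately show ?case using IH by simp
qed

section \<open>Placements that occupy every column\<close>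

lemma placements_image:
  assumes "\<tau> \<in> placements B n l" "\<forall>j\<in>{1..n}. l j \<le> n"
  shows "\<tau> ` {1..n} = {1..n}"
proof (rule endo_inj_surj)
  show "\<tau> ` {1..n} \<subseteq> {1..n}"
  proof
    fix x assume "x \<in> \<tau> ` {1..n}"
    then obtain j where "j \<in> {1..n}" "x = \<tau> j" by auto
    then show "x \<in> {1..n}"
      using assms by (fastforce simp: placements_def dest: PiE_mem)
  qed
qed (use assms in \<open>auto simp: placements_def\<close>)

text \<open>An injective self-map of \<open>{1..n}\<close> is onto; hence after the insertion every
  column except \<open>c\<close> holds the 1 of an old row.\<close>

lemma placements_shift_surj:
  assumes "\<tau> \<in> placements B n l" "\<forall>j\<in>{1..n}. l j \<le> n"
    and c: "1 \<le> c" "c \<le> Suc n" and x: "1 \<le> x" "x \<le> Suc n" "x \<noteq> c"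
  obtains r where "1 \<le> r" "r \<le> n" "shift c (\<tau> r) = x"
proof -
  obtain y where y: "x = shift c y" using x(3) by (rule shift_surj)
  have "1 \<le> y" using x(1) one_le_shift_iff[OF c(1)] y by simp
  moreover have "y \<le> n" using x(2) shift_le_iff[OF c] y by simp
  ultimately have "y \<in> \<tau> ` {1..n}" using placements_image[OF assms(1,2)] by simp
  then show ?thesis using that y by auto
qed

text \<open>If the two lower rows play the same role in \<open>B\<close>, it does not matter which
  of two columns has the higher 1. As all columns are occupied, the admissible positions then depend
  on \<open>m\<close> alone and not on \<open>\<tau>\<close>.\<close>

lemma insertions_symmetric:
  assumes sym: "\<And>x y z. B x y z \<longleftrightarrow> B y x z"
    and \<tau>: "\<tau> \<in> placements B n l" "\<forall>j\<in>{1..n}. l j \<le> n" and m: "m \<le> Suc n"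
  shows "insertions B n m \<tau> =
    {c \<in> {1..m}. \<forall>x\<in>{1..m} - {c}. \<forall>y\<in>{1..m} - {c}. x \<noteq> y \<longrightarrow> \<not> B x y c}"
  unfolding insertions_def
proof (intro Collect_cong conj_cong refl iffI ballI allI impI)
  fix c x y
  assume c: "c \<in> {1..m}" and ins: "\<forall>r1 r2. 1 \<le> r1 \<and> r1 < r2 \<and> r2 \<le> n \<and>
      shift c (\<tau> r1) \<le> m \<and> shift c (\<tau> r2) \<le> m \<longrightarrow> \<not> B (shift c (\<tau> r1)) (shift c (\<tau> r2)) c"
    and xy: "x \<in> {1..m} - {c}" "y \<in> {1..m} - {c}" "x \<noteq> y"
  obtain r where r: "1 \<le> r" "r \<le> n" "shift c (\<tau> r) = x"
    by (rule placements_shift_surj[OF \<tau>, of c x]) (use c xy m in auto)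
  obtain s where s: "1 \<le> s" "s \<le> n" "shift c (\<tau> s) = y"
    by (rule placements_shift_surj[OF \<tau>, of c y]) (use c xy m in auto)
  have "r \<noteq> s" using r s xy(3) by auto
  then consider "r < s" | "s < r" by linarith
  then show "\<not> B x y c"
  proof cases
    case 1
    then show ?thesis using ins[rule_format, of r s] r s xy by auto
  next
    case 2
    then show ?thesis using ins[rule_format, of s r] r s xy sym[of x y c] by auto
  qed
next
  fix c r1 r2
  assume c: "c \<in> {1..m}" and *: "\<forall>x\<in>{1..m} - {c}. \<forall>y\<in>{1..m} - {c}. x \<noteq> y \<longrightarrow> \<not> B x y c"
    and r: "1 \<le> r1 \<and> r1 < r2 \<and> r2 \<le> n \<and> shift c (\<tau> r1) \<le> m \<and> shift c (\<tau> r2) \<le> m"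
  have pos: "1 \<le> shift c (\<tau> j)" if "1 \<le> j" "j \<le> n" for j
    using \<tau>(1) that c one_le_shift_iff[of c "\<tau> j"] by (fastforce simp: placements_def dest: PiE_mem)
  have "\<tau> r1 \<noteq> \<tau> r2"
    using \<tau>(1) r by (auto simp: placements_def dest!: inj_onD[of \<tau> _ r1 r2])
  then show "\<not> B (shift c (\<tau> r1)) (shift c (\<tau> r2)) c"
    using * r pos[of r1] pos[of r2] by auto
qed

section \<open>Counting insertions for the two kinds of pattern\<close>

text \<open>Here \<open>z\<close> is the column of the highest 1, and the largest letter is the
  \<open>a\<close>-th one when \<open>z\<close> is the \<open>a\<close>-th of the three columns from
  the left.\<close>

definition top_bad :: "nat \<Rightarrow> nat \<Rightarrow> nat \<Rightarrow> nat \<Rightarrow> bool" where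
  "top_bad a x y z \<longleftrightarrow>
     (if a = 1 then z < x \<and> z < y
      else if a = 2 then x < z \<and> z < y \<or> y < z \<and> z < x
      else x < z \<and> y < z)"

text \<open>The lowest 1 stands between the other two: the first disjunct is the pattern 213, the
  second is 312.\<close>

definition V_bad :: "nat \<Rightarrow> nat \<Rightarrow> nat \<Rightarrow> bool" where
  "V_bad x y z \<longleftrightarrow> y < x \<and> x < z \<or> z < x \<and> x < y"

lemma order_invariant_top_bad: "order_invariant (top_bad a)"
  by (simp add: order_invariant_def top_bad_def strict_mono_less)

lemma order_invariant_V_bad: "order_invariant V_bad"
  by (simp add: order_invariant_def V_bad_def strict_mono_less)

text \<open>The new maximum must not have two columns to its right (\<open>a = 1\<close>), one on
  each side (\<open>a = 2\<close>) or two to its left (\<open>a = 3\<close>), within the first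
  \<open>m\<close> columns. This leaves the last two columns, the two end columns or the first two
  columns.\<close>

lemma two_insertions_top_bad: "two_insertions (top_bad a)"
  unfolding two_insertions_def
proof (intro allI impI, elim conjE)
  fix n l \<tau>
  assume l: "\<forall>j\<in>{1..Suc n}. l j \<le> Suc n" and \<tau>: "\<tau> \<in> placements (top_bad a) n (\<lambda>j. l j - 1)"
  define m where "m = l (Suc n)"
  have ins: "insertions (top_bad a) n m \<tau> =
      {c \<in> {1..m}. \<forall>x\<in>{1..m} - {c}. \<forall>y\<in>{1..m} - {c}. x \<noteq> y \<longrightarrow> \<not> top_bad a x y c}"
    by (rule insertions_symmetric[OF _ \<tau>]) (use l in \<open>auto simp: top_bad_def m_def le_diff_conv\<close>)
  \<comment> \<open>The \<open>max\<close> and \<open>min\<close> make the two positions coincide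
    when \<open>m = 1\<close>.\<close>
  have "insertions (top_bad a) n m \<tau> =
      (if m = 0 then {} else if a = 1 then {m, max 1 (m - 1)} else if a = 2 then {1, m} else {1, min 2 m})"
    (is "_ = ?C")
  proof (intro equalityI subsetI)
    fix c assume c: "c \<in> insertions (top_bad a) n m \<tau>"
    have c1: "1 \<le> c" "c \<le> m" using c ins by auto
    have *: "\<not> top_bad a x y c" if "1 \<le> x" "x \<le> m" "1 \<le> y" "y \<le> m" "x \<noteq> c" "y \<noteq> c" "x \<noteq> y" for x y
      using c that unfolding ins by auto
    show "c \<in> ?C"
    proof (rule ccontr)
      assume nc: "c \<notin> ?C"
      \<comment> \<open>In each case the columns nearest to \<open>c\<close> on the critical side or
        sides form a bad triple with it.\<close>
      consider "a = 1" | "a = 2" | "a \<noteq> 1" "a \<noteq> 2" by blast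
      then show False
      proof cases
        case 1
        then have "c + 2 \<le> m" using nc c1 by auto
        then show False using *[of "c + 1" "c + 2"] c1 1 by (simp add: top_bad_def)
      next
        case 2
        then have "2 \<le> c" "c + 1 \<le> m" using nc c1 by auto
        moreover from this have "1 \<le> c - 1" "c - 1 < c" "c - 1 \<noteq> c + 1" "c - 1 \<le> m" "c - 1 \<noteq> c" by linarith+
        ultimately show False using *[of "c - 1" "c + 1"] 2 by (simp add: top_bad_def)
      next
        case 3
        then have "3 \<le> c" using nc c1 by auto
        then have "c - 1 \<noteq> c" "c - 2 \<noteq> c" "c - 1 \<noteq> c - 2" "1 \<le> c - 1" "1 \<le> c - 2"
          "c - 1 \<le> m" "c - 2 \<le> m" using c1 by linarith+
        then show False using *[of "c - 1" "c - 2"] c1 3 by (simp add: top_bad_def)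
      qed
    qed
  next
    fix c assume "c \<in> ?C"
    then show "c \<in> insertions (top_bad a) n m \<tau>"
      unfolding ins by (auto simp: top_bad_def split: if_splits)
  qed
  then show "card (insertions (top_bad a) n (l (Suc n)) \<tau>) = min 2 (l (Suc n))"
    by (auto simp: m_def[symmetric] card_insert_if)
qed

text \<open>Let row \<open>t\<close> be the highest one with its 1 among the columns that remain
  under the new row. If \<open>c\<close> is not next to that 1, a column strictly between them holds
  a lower 1, which is forbidden. If it is next to it, any bad triple ending in the new row gives one
  in \<open>\<tau>\<close> ending in row \<open>t\<close>.\<close>

lemma two_insertions_V_bad: "two_insertions V_bad"
  unfolding two_insertions_def
proof (intro allI impI, elim conjE)
  fix n l \<tau>
  assume anti: "antimono_on {1..Suc n} l"
    and l: "\<forall>j\<in>{1..Suc n}. l j \<le> Suc n" and \<tau>: "\<tau> \<in> placements V_bad n (\<lambda>j. l j - 1)"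
  have l': "\<forall>j\<in>{1..n}. l j - 1 \<le> n" using l by (auto simp: le_diff_conv)
  define m where "m = l (Suc n)"
  have m: "m \<le> Suc n" using l by (simp add: m_def)
  have inj: "inj_on \<tau> {1..n}" using \<tau> by (simp add: placements_def)
  have pos: "1 \<le> \<tau> j" if "1 \<le> j" "j \<le> n" for j
    using \<tau> that by (fastforce simp: placements_def dest: PiE_mem)
  have "card (insertions V_bad n m \<tau>) = min 2 m"
  proof (cases "m \<ge> 2")
    case False
    then consider "m = 0" | "m = 1" by linarith
    then show ?thesis
    proof cases
      case 2
      \<comment> \<open>The insertion moves every old column to at least 2, beyond a top row of
        length 1, so there is no triple to check.\<close>
      have "insertions V_bad n 1 \<tau> = {1}"
        using pos by (fastforce simp: insertions_def V_bad_def shift_def)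
      then show ?thesis using 2 by simp
    qed (simp add: insertions_def)
  next
    case True
    \<comment> \<open>\<open>\<tau> t\<close> is the position of the maximum of the unimodal word on the columns up to \<open>m - 1\<close>.\<close>
    define R where "R = {r \<in> {1..n}. \<tau> r \<le> m - 1}"
    define t where "t = Max R"
    \<comment> \<open>As \<open>m\<close> is at least 2, column 1 is among the first
      \<open>m - 1\<close>, and the row of its 1 shows that \<open>R\<close> is nonempty.\<close>
    have "1 \<in> \<tau> ` {1..n}" using placements_image[OF \<tau> l'] m True by simp
    then have "R \<noteq> {}" using True by (auto simp: R_def image_iff)
    moreover have fR: "finite R" by (simp add: R_def)
    ultimately have "t \<in> R" unfolding t_def by (rule Max_in[rotated])
    then have t: "1 \<le> t" "t \<le> n" "\<tau> t \<le> m - 1" by (auto simp: R_def)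
    have tmax: "r \<le> t" if "1 \<le> r" "r \<le> n" "\<tau> r \<le> m - 1" for r
      unfolding t_def by (rule Max_ge[OF fR]) (use that in \<open>simp add: R_def\<close>)
    \<comment> \<open>In the smaller board row \<open>t\<close> thus reaches at least
      \<open>m - 1\<close> columns, so avoidance in \<open>\<tau>\<close> applies to triples with
      top row \<open>t\<close>.\<close>
    have lt: "m \<le> l t"
      using monotone_onD[OF anti, of t "Suc n"] t by (simp add: m_def)
    have "insertions V_bad n m \<tau> = {\<tau> t, Suc (\<tau> t)}"
    proof (intro equalityI subsetI)
      fix c assume "c \<in> insertions V_bad n m \<tau>"
      then have c: "1 \<le> c" "c \<le> m"
        and *: "\<And>r1 r2. 1 \<le> r1 \<Longrightarrow> r1 < r2 \<Longrightarrow> r2 \<le> n \<Longrightarrow> shift c (\<tau> r1) \<le> m \<Longrightarrow>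
          shift c (\<tau> r2) \<le> m \<Longrightarrow> \<not> V_bad (shift c (\<tau> r1)) (shift c (\<tau> r2)) c"
        by (auto simp: insertions_def)
      \<comment> \<open>Column \<open>x\<close> is occupied by a row below \<open>t\<close>, so this
        row, row \<open>t\<close> and the new row are in the order that the insertion condition
        requires.\<close>
      have free: "\<not> V_bad x (shift c (\<tau> t)) c" if x: "1 \<le> x" "x \<le> m" "x \<noteq> c" "x \<noteq> shift c (\<tau> t)" for x
      proof -
        obtain r where r: "1 \<le> r" "r \<le> n" "shift c (\<tau> r) = x"
          by (rule placements_shift_surj[OF \<tau> l', of c x]) (use c x m in auto)
        have "\<tau> r \<le> m - 1" using r(3) x(2) shift_le_iff[OF c, of "\<tau> r"] by simp
        then have "r \<le> t" using r tmax by blast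
        moreover have "r \<noteq> t" using r(3) x(4) by auto
        ultimately show ?thesis
          using *[of r t] r x t shift_le_iff[OF c] by simp
      qed
      show "c \<in> {\<tau> t, Suc (\<tau> t)}"
      proof (rule ccontr)
        assume "c \<notin> {\<tau> t, Suc (\<tau> t)}"
        then consider "c < \<tau> t" | "Suc (\<tau> t) < c" by fastforce
        then show False
        proof cases
          case 1
          \<comment> \<open>The neighbour of \<open>c\<close> on the side of the old maximum,
            \<open>c + 1\<close> here and \<open>c - 1\<close> in the other case, lies strictly
            between the two.\<close>
          then have "c + 1 \<le> m" using t by linarith
          then show False using free[of "c + 1"] 1 by (simp add: V_bad_def shift_def)
        next
          case 2
          then have "\<tau> t < c - 1" "c - 1 < c" "c - 1 \<noteq> c" "c - 1 \<le> m" using c by linarith+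
          then show False using free[of "c - 1"] c 2 by (simp add: V_bad_def shift_def)
        qed
      qed
    next
      fix c assume cC: "c \<in> {\<tau> t, Suc (\<tau> t)}"
      have c: "1 \<le> c" "c \<le> m" using cC pos[OF t(1,2)] t(3) True by auto
      have "\<not> V_bad (shift c (\<tau> r1)) (shift c (\<tau> r2)) c"
        if r: "1 \<le> r1" "r1 < r2" "r2 \<le> n" "shift c (\<tau> r1) \<le> m" "shift c (\<tau> r2) \<le> m" for r1 r2
      proof
        assume V: "V_bad (shift c (\<tau> r1)) (shift c (\<tau> r2)) c"
        have le: "\<tau> r1 \<le> m - 1" "\<tau> r2 \<le> m - 1" using r shift_le_iff[OF c] by auto
        have "r2 \<le> t" using tmax le r by simp
        have "r1 \<noteq> t" using \<open>r2 \<le> t\<close> r by simp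
        then have ne: "\<tau> r1 \<noteq> \<tau> t" using inj_onD[OF inj, of r1 t] r t by auto
        \<comment> \<open>After the shift, \<open>c\<close> and the column of row \<open>t\<close>
          are adjacent, so no column lies strictly between them.\<close>
        have "r2 \<noteq> t"
        proof
          assume "r2 = t"
          then show False using V cC ne by (auto simp: V_bad_def shift_def split: if_splits)
        qed
        then have "r2 < t" using \<open>r2 \<le> t\<close> by simp
        \<comment> \<open>Because of this adjacency, column \<open>\<tau> r1\<close> lies on the
          same side of \<open>\<tau> t\<close> as its shifted copy does of \<open>c\<close>.\<close>
        moreover have "V_bad (\<tau> r1) (\<tau> r2) (\<tau> t)"
          using V cC ne by (auto simp: V_bad_def shift_def split: if_splits)
        ultimately show False
          using \<tau> r le t lt unfolding placements_def by fastforce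
      qed
      then show "c \<in> insertions V_bad n m \<tau>" using c by (auto simp: insertions_def)
    qed
    then show ?thesis using True by simp
  qed
  then show "card (insertions V_bad n (l (Suc n)) \<tau>) = min 2 (l (Suc n))" by (simp add: m_def)
qed


section \<open>Ferrers boards given by their row lengths\<close>

definition row_board :: "nat \<Rightarrow> (nat \<Rightarrow> nat) \<Rightarrow> (nat \<times> nat) set" where
  "row_board n l = {(i, j). 1 \<le> i \<and> i \<le> l j \<and> 1 \<le> j \<and> j \<le> n}"

lemma initial_segment_eq:
  fixes S :: "nat set"
  assumes "finite S" "\<And>i i'. i \<in> S \<Longrightarrow> 1 \<le> i \<and> (1 \<le> i' \<and> i' \<le> i \<longrightarrow> i' \<in> S)"
  shows "S = {1..card S}"
proof (cases "S = {}")
  case False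
  then have max: "Max S \<in> S" using assms(1) by (rule Max_in[rotated])
  have "S = {1..Max S}"
  proof (intro equalityI subsetI)
    fix i assume "i \<in> S"
    then show "i \<in> {1..Max S}" using assms(2)[of i i] Max_ge[OF assms(1), of i] by simp
  next
    fix i assume "i \<in> {1..Max S}"
    then show "i \<in> S" using assms(2)[OF max, of i] by simp
  qed
  then show ?thesis by (metis card_atLeastAtMost diff_Suc_1)
qed simp

text \<open>Downward closure makes the set of row indices and each row an initial segment of the
  positive integers, so cardinalities determine the board.\<close>

lemma ferrers_board_rows:
  assumes "ferrers_board F"
  obtains n l where "F = row_board n l" "antimono_on {1..n} l" "\<forall>j\<in>{1..n}. 1 \<le> l j"
proof
  let ?n = "card (snd ` F)" and ?l = "\<lambda>j. card {i. (i, j) \<in> F}"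
  have fin: "finite F" and pos: "\<And>i j. (i, j) \<in> F \<Longrightarrow> 1 \<le> i \<and> 1 \<le> j"
    and down: "\<And>i j i' j'. (i, j) \<in> F \<Longrightarrow> 1 \<le> i' \<Longrightarrow> i' \<le> i \<Longrightarrow> 1 \<le> j' \<Longrightarrow> j' \<le> j \<Longrightarrow> (i', j') \<in> F"
    using assms unfolding ferrers_board_def by blast+
  have fin_row: "finite {i. (i, j) \<in> F}" for j
    by (rule finite_subset[of _ "fst ` F"]) (use fin in \<open>force+\<close>)
  have rows: "snd ` F = {1..?n}"
  proof (rule initial_segment_eq)
    fix j j' assume "j \<in> snd ` F"
    then obtain i where "(i, j) \<in> F" by auto
    then show "1 \<le> j \<and> (1 \<le> j' \<and> j' \<le> j \<longrightarrow> j' \<in> snd ` F)"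
      using pos[of i j] down[of i j i j'] by (metis image_eqI order_refl snd_conv)
  qed (use fin in simp)
  have row: "{i. (i, j) \<in> F} = {1..?l j}" for j
  proof (rule initial_segment_eq)
    fix i i' assume "i \<in> {i. (i, j) \<in> F}"
    then show "1 \<le> i \<and> (1 \<le> i' \<and> i' \<le> i \<longrightarrow> i' \<in> {i. (i, j) \<in> F})"
      using pos[of i j] down[of i j i' j] by simp
  qed (rule fin_row)
  show "F = row_board ?n ?l"
  proof (intro set_eqI, clarify)
    fix i j
    have "(i, j) \<in> F \<longleftrightarrow> i \<in> {i. (i, j) \<in> F} \<and> j \<in> snd ` F" by force
    also have "\<dots> \<longleftrightarrow> i \<in> {1..?l j} \<and> j \<in> {1..?n}" 
      using row[of j] rows by blast
    finally show "(i, j) \<in> F \<longleftrightarrow> (i, j) \<in> row_board ?n ?l" by (simp add: row_board_def)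
  qed
  show "antimono_on {1..?n} ?l"
  proof (rule monotone_onI)
    fix j j' assume "j \<in> {1..?n}" "j' \<in> {1..?n}" "j \<le> j'"
    then have "(i, j) \<in> F" if "(i, j') \<in> F" for i
      using pos[OF that] down[OF that, of i j] by simp
    then have "{i. (i, j') \<in> F} \<subseteq> {i. (i, j) \<in> F}" by blast
    then show "?l j' \<le> ?l j" by (rule card_mono[OF fin_row])
  qed
  show "\<forall>j\<in>{1..?n}. 1 \<le> ?l j"
  proof
    fix j assume "j \<in> {1..?n}"
    then have "j \<in> snd ` F" using rows by blast
    then have "{i. (i, j) \<in> F} \<noteq> {}" by auto
    then show "1 \<le> ?l j" using fin_row[of j] by (simp add: Suc_le_eq card_gt_0_iff)
  qed
qed

section \<open>Fillings as injective choices of a column in each row\<close>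

lemma fillings_column:
  assumes "f \<in> fillings F" "(i, j) \<in> F"
  shows "\<exists>!j. (i, j) \<in> F \<and> f (i, j) = 1"
proof -
  have "\<forall>i\<in>fst ` F. \<exists>!j. (i, j) \<in> F \<and> f (i, j) = 1"
    using assms(1) unfolding fillings_def mem_Collect_eq by (elim conjE)
  moreover have "i \<in> fst ` F" using imageI[OF assms(2), of fst] by simp
  ultimately show ?thesis by (rule bspec)
qed

lemma fillings_row:
  assumes "f \<in> fillings F" "(i, j) \<in> F"
  shows "\<exists>!i. (i, j) \<in> F \<and> f (i, j) = 1"
proof -
  have "\<forall>j\<in>snd ` F. \<exists>!i. (i, j) \<in> F \<and> f (i, j) = 1"
    using assms(1) unfolding fillings_def mem_Collect_eq by (elim conjE)
  moreover have "j \<in> snd ` F" using imageI[OF assms(2), of snd] by simp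
  ultimately show ?thesis by (rule bspec)
qed

text \<open>The \<open>l j\<close> columns that meet row \<open>j\<close> have their 1s in distinct
  rows, of which there are only \<open>n\<close>.\<close>

lemma fillings_row_le:
  assumes "f \<in> fillings (row_board n l)" "j \<in> {1..n}"
  shows "l j \<le> n"
proof -
  let ?F = "row_board n l"
  have "\<forall>i\<in>{1..l j}. \<exists>k. (i, k) \<in> ?F \<and> f (i, k) = 1"
  proof
    fix i assume "i \<in> {1..l j}"
    then have "(i, j) \<in> ?F" using assms(2) by (simp add: row_board_def)
    then show "\<exists>k. (i, k) \<in> ?F \<and> f (i, k) = 1"
      by (rule ex1_implies_ex[OF fillings_column[OF assms(1)]])
  qed
  then obtain g where g: "\<And>i. i \<in> {1..l j} \<Longrightarrow> (i, g i) \<in> ?F \<and> f (i, g i) = 1" by metis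
  have "inj_on g {1..l j}"
  proof (rule inj_onI)
    fix i i' assume i: "i \<in> {1..l j}" "i' \<in> {1..l j}" and eq: "g i = g i'"
    have "\<exists>!k. (k, g i) \<in> ?F \<and> f (k, g i) = 1"
      using assms(1) conjunct1[OF g[OF i(1)]] by (rule fillings_row)
    then show "i = i'" using g[OF i(1)] g[OF i(2)] eq by metis
  qed
  moreover have "g ` {1..l j} \<subseteq> {1..n}"
    using g by (fastforce simp: row_board_def)
  ultimately have "card {1..l j} \<le> card {1..n}" by (intro card_inj_on_le) auto
  then show ?thesis by simp
qed

definition fill :: "nat \<Rightarrow> (nat \<Rightarrow> nat) \<Rightarrow> (nat \<Rightarrow> nat) \<Rightarrow> nat \<times> nat \<Rightarrow> nat" where
  "fill n l \<sigma> = (\<lambda>(i, j)\<in>row_board n l. if \<sigma> j = i then 1 else 0)"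

lemma fill_eq_1_iff: "(i, j) \<in> row_board n l \<Longrightarrow> fill n l \<sigma> (i, j) = 1 \<longleftrightarrow> \<sigma> j = i"
  by (simp add: fill_def)

text \<open>The bound \<open>n\<close> on the row lengths makes an injective choice a permutation of
  \<open>{1..n}\<close>, so every column receives a 1. Conversely, the choice is read off from the
  unique 1 of each row.\<close>

lemma bij_betw_fill:
  assumes l: "\<forall>j\<in>{1..n}. 1 \<le> l j \<and> l j \<le> n"
  shows "bij_betw (fill n l) {\<sigma> \<in> (\<Pi>\<^sub>E j\<in>{1..n}. {1..l j}). inj_on \<sigma> {1..n}} (fillings (row_board n l))"
proof (rule bij_betw_imageI)
  let ?F = "row_board n l" and ?S = "{\<sigma> \<in> (\<Pi>\<^sub>E j\<in>{1..n}. {1..l j}). inj_on \<sigma> {1..n}}"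
  have cell: "(\<sigma> j, j) \<in> ?F" if "\<sigma> \<in> ?S" "j \<in> {1..n}" for \<sigma> j
    using that by (fastforce simp: row_board_def dest: PiE_mem)
  have rows: "snd ` ?F = {1..n}"
    using l by (force simp: row_board_def image_iff)
  have columns: "fst ` ?F \<subseteq> {1..n}"
  proof
    fix i assume "i \<in> fst ` ?F"
    then obtain j where "j \<in> {1..n}" "1 \<le> i" "i \<le> l j" by (auto simp: row_board_def)
    then show "i \<in> {1..n}" using l by (meson atLeastAtMost_iff order_trans)
  qed
  show "inj_on (fill n l) ?S"
  proof (rule inj_onI)
    fix \<sigma> \<sigma>' assume \<sigma>: "\<sigma> \<in> ?S" "\<sigma>' \<in> ?S" and eq: "fill n l \<sigma> = fill n l \<sigma>'"
    show "\<sigma> = \<sigma>'"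
    proof (rule extensionalityI)
      fix j assume j: "j \<in> {1..n}"
      have "fill n l \<sigma>' (\<sigma> j, j) = 1"
        using fill_eq_1_iff[OF cell[OF \<sigma>(1) j]] eq by metis
      then show "\<sigma> j = \<sigma>' j"
        using fill_eq_1_iff[OF cell[OF \<sigma>(1) j]] by metis
    qed (use \<sigma> in \<open>auto simp: PiE_def\<close>)
  qed
  show "fill n l ` ?S = fillings ?F"
  proof (intro equalityI subsetI)
    fix f assume "f \<in> fill n l ` ?S"
    then obtain \<sigma> where \<sigma>: "\<sigma> \<in> ?S" and f: "f = fill n l \<sigma>" by auto
    have "\<sigma> ` {1..n} \<subseteq> {1..n}"
      using cell[OF \<sigma>] columns by force
    then have surj: "\<sigma> ` {1..n} = {1..n}"
      using \<sigma> by (intro endo_inj_surj) auto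
    have "\<exists>!j. (i, j) \<in> ?F \<and> f (i, j) = 1" if i: "i \<in> fst ` ?F" for i
    proof -
      obtain j where j: "j \<in> {1..n}" "i = \<sigma> j" using i columns surj by blast
      show ?thesis
      proof (rule ex1I[of _ j])
        show "(i, j) \<in> ?F \<and> f (i, j) = 1"
          using cell[OF \<sigma> j(1)] j(2) by (simp add: f fill_eq_1_iff[simplified])
      next
        fix k assume k: "(i, k) \<in> ?F \<and> f (i, k) = 1"
        then have "\<sigma> k = \<sigma> j" using j(2) fill_eq_1_iff[of i k n l \<sigma>] by (simp add: f)
        moreover have "k \<in> {1..n}" using k by (simp add: row_board_def)
        ultimately show "k = j" using \<sigma> j inj_onD[of \<sigma> "{1..n}" k j] by simp
      qed
    qed
    moreover have "\<exists>!i. (i, j) \<in> ?F \<and> f (i, j) = 1" if j: "j \<in> snd ` ?F" for j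
    proof (rule ex1I[of _ "\<sigma> j"])
      show "(\<sigma> j, j) \<in> ?F \<and> f (\<sigma> j, j) = 1"
        using cell[OF \<sigma>, of j] j unfolding rows by (simp add: f fill_eq_1_iff[simplified])
    next
      fix i assume "(i, j) \<in> ?F \<and> f (i, j) = 1"
      then show "i = \<sigma> j" using fill_eq_1_iff[of i j n l \<sigma>] by (simp add: f)
    qed
    moreover have "f \<in> ?F \<rightarrow>\<^sub>E {0, 1}" by (auto simp: f fill_def split: if_splits)
    ultimately show "f \<in> fillings ?F" by (simp add: fillings_def)
  next
    fix f assume f: "f \<in> fillings ?F"
    have ext: "f \<in> ?F \<rightarrow>\<^sub>E {0, 1}" using f by (simp add: fillings_def)
    have row: "\<exists>!i. (i, j) \<in> ?F \<and> f (i, j) = 1" if j: "j \<in> {1..n}" for j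
    proof -
      \<comment> \<open>Row \<open>j\<close> is nonempty, so the filling does have a 1 in
        it.\<close>
      have "(1, j) \<in> ?F" using l j by (simp add: row_board_def)
      then show ?thesis by (rule fillings_row[OF f])
    qed
    obtain s where s: "\<And>j. j \<in> {1..n} \<Longrightarrow> (s j, j) \<in> ?F \<and> f (s j, j) = 1" using row by metis
    let ?\<sigma> = "restrict s {1..n}"
    have "inj_on ?\<sigma> {1..n}"
    proof (rule inj_onI)
      fix j k assume jk: "j \<in> {1..n}" "k \<in> {1..n}" "?\<sigma> j = ?\<sigma> k"
      show "j = k" using fillings_column[OF f conjunct1[OF s[OF jk(1)]]] s[OF jk(1)] s[OF jk(2)] jk by (metis restrict_apply')
    qed
    moreover have "?\<sigma> \<in> (\<Pi>\<^sub>E j\<in>{1..n}. {1..l j})"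
      using s by (auto simp: row_board_def)
    ultimately have \<sigma>: "?\<sigma> \<in> ?S" by simp
    have "fill n l ?\<sigma> = f"
    proof (rule extensionalityI[where A = ?F])
      fix x assume x: "x \<in> ?F"
      obtain i j where ij: "x = (i, j)" by force
      have j: "j \<in> {1..n}" using x ij by (simp add: row_board_def)
      \<comment> \<open>A filling takes only the values 0 and 1, so the positions of its 1s
        determine it.\<close>
      have "f (i, j) = 1 \<longleftrightarrow> s j = i" using row[OF j] s[OF j] x ij by metis
      moreover have "f (i, j) \<in> {0, 1}" using ext x ij by (metis PiE_mem)
      ultimately show "fill n l ?\<sigma> x = f x" using x ij j by (auto simp: fill_def)
    qed (use ext in \<open>auto simp: fill_def PiE_def\<close>)
    then show "f \<in> fill n l ` ?S" using imageI[OF \<sigma>, of "fill n l"] by (simp only:)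
  qed
qed

section \<open>Pattern containment in terms of columns\<close>

lemma strict_mono_on_3:
  fixes g :: "nat \<Rightarrow> nat"
  shows "strict_mono_on {1..3} g \<longleftrightarrow> g 1 < g 2 \<and> g 2 < g 3"
proof -
  have "{1..3::nat} = {1, 2, 3}" by auto
  then show ?thesis by (auto simp: strict_mono_on_def)
qed

text \<open>\<open>x b\<close> is the column of the 1 in the \<open>b\<close>-th of three rows. When
  \<open>x \<circ> r\<close> increases, it lists these columns from left to right, so the 1s form
  the classical pattern \<open>r\<close>, the inverse of the standardization of
  \<open>x\<close>.\<close>

definition represents :: "(nat \<Rightarrow> nat \<Rightarrow> nat \<Rightarrow> bool) \<Rightarrow> pattern set \<Rightarrow> bool" where
  "represents B R \<longleftrightarrow> (\<forall>x. inj_on x {1..3} \<longrightarrow>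
     B (x 1) (x 2) (x 3) = (\<exists>r. (3, r) \<in> R \<and> strict_mono_on {1..3} (x \<circ> r)))"

text \<open>An occurrence is determined by its rows \<open>\<rho>\<close> and its pattern
  \<open>r\<close>, since its columns must be \<open>\<sigma> \<circ> \<rho> \<circ> r\<close>. All
  nine cells lie in the board once the top row reaches the three columns, as lower rows are at least
  as long.\<close>

lemma fill_contains_iff:
  assumes R: "\<And>k r. (k, r) \<in> R \<Longrightarrow> k = 3 \<and> r permutes {1..3}" and B: "represents B R"
    and anti: "antimono_on {1..n} l"
    and \<sigma>: "\<sigma> \<in> (\<Pi>\<^sub>E j\<in>{1..n}. {1..l j})" "inj_on \<sigma> {1..n}"
  shows "(\<exists>p\<in>R. contains_pattern (row_board n l) (fill n l \<sigma>) p) \<longleftrightarrow>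
    (\<exists>r1 r2 r3. 1 \<le> r1 \<and> r1 < r2 \<and> r2 < r3 \<and> r3 \<le> n \<and> \<sigma> r1 \<le> l r3 \<and> \<sigma> r2 \<le> l r3 \<and>
       B (\<sigma> r1) (\<sigma> r2) (\<sigma> r3))"
proof
  let ?F = "row_board n l"
  assume "\<exists>p\<in>R. contains_pattern ?F (fill n l \<sigma>) p"
  then obtain r where rR: "(3, r) \<in> R" and con: "contains_pattern ?F (fill n l \<sigma>) (3, r)"
    using R by (metis surj_pair)
  have r: "r permutes {1..3}" using R rR by blast
  obtain c \<rho> where c: "strict_mono_on {1..3} c" and \<rho>: "strict_mono_on {1..3} \<rho>"
    and cells: "\<And>x y. x \<in> {1..3} \<Longrightarrow> y \<in> {1..3} \<Longrightarrow>
      (c x, \<rho> y) \<in> ?F \<and> (fill n l \<sigma> (c x, \<rho> y) = 1 \<longleftrightarrow> r x = y)"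
    using con unfolding contains_pattern_def prod.case by blast
  have rin: "r x \<in> {1..3}" if "x \<in> {1..3}" for x using permutes_in_image[OF r] that by simp
  have c_eq: "(\<sigma> \<circ> \<rho> \<circ> r) x = c x" if "x \<in> {1..3}" for x
    using cells[OF that rin[OF that]] fill_eq_1_iff by auto
  then have sm: "strict_mono_on {1..3} (\<sigma> \<circ> \<rho> \<circ> r)"
    using c unfolding strict_mono_on_3 by simp
  have \<rho>n: "\<rho> y \<in> {1..n}" if "y \<in> {1..3}" for y
    using cells[of 1 y] that by (simp add: row_board_def)
  have "inj_on (\<sigma> \<circ> \<rho>) {1..3}"
    using \<rho>n by (intro comp_inj_on strict_mono_on_imp_inj_on[OF \<rho>] inj_on_subset[OF \<sigma>(2)]) auto
  then have "B (\<sigma> (\<rho> 1)) (\<sigma> (\<rho> 2)) (\<sigma> (\<rho> 3))"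
    using B rR sm unfolding represents_def by auto
  \<comment> \<open>Each of these columns is some \<open>c x\<close>, and the occurrence includes
    the cell of \<open>c x\<close> in its top row.\<close>
  moreover have "\<sigma> (\<rho> y) \<le> l (\<rho> 3)" if y: "y \<in> {1..3}" for y
  proof -
    obtain x where "x \<in> {1..3}" "y = r x" using permutes_image[OF r] y by blast
    then show ?thesis using c_eq[of x] cells[of x 3] by (simp add: row_board_def)
  qed
  ultimately show "\<exists>r1 r2 r3. 1 \<le> r1 \<and> r1 < r2 \<and> r2 < r3 \<and> r3 \<le> n \<and> \<sigma> r1 \<le> l r3 \<and>
      \<sigma> r2 \<le> l r3 \<and> B (\<sigma> r1) (\<sigma> r2) (\<sigma> r3)"
    using \<rho> \<rho>n[of 1] \<rho>n[of 3] unfolding strict_mono_on_3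
    by (intro exI[of _ "\<rho> 1"] exI[of _ "\<rho> 2"] exI[of _ "\<rho> 3"]) auto
next
  let ?F = "row_board n l"
  assume "\<exists>r1 r2 r3. 1 \<le> r1 \<and> r1 < r2 \<and> r2 < r3 \<and> r3 \<le> n \<and> \<sigma> r1 \<le> l r3 \<and>
      \<sigma> r2 \<le> l r3 \<and> B (\<sigma> r1) (\<sigma> r2) (\<sigma> r3)"
  then obtain r1 r2 r3 where rows: "1 \<le> r1" "r1 < r2" "r2 < r3" "r3 \<le> n"
    and le: "\<sigma> r1 \<le> l r3" "\<sigma> r2 \<le> l r3" and Br: "B (\<sigma> r1) (\<sigma> r2) (\<sigma> r3)"
    by blast
  \<comment> \<open>Every argument other than 1 and 2 is sent to \<open>r3\<close>, so the bounds
    below hold for all \<open>y\<close> without a side condition.\<close>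
  define \<rho> :: "nat \<Rightarrow> nat" where "\<rho> = (\<lambda>y. if y = 1 then r1 else if y = 2 then r2 else r3)"
  have \<rho>_simps: "\<rho> 1 = r1" "\<rho> 2 = r2" "\<rho> 3 = r3" by (simp_all add: \<rho>_def)
  have \<rho>: "strict_mono_on {1..3} \<rho>" unfolding strict_mono_on_3 \<rho>_simps using rows by simp
  have \<rho>n: "\<rho> y \<in> {1..n}" "\<rho> y \<le> r3" for y using rows by (auto simp: \<rho>_def)
  have inj: "inj_on (\<sigma> \<circ> \<rho>) {1..3}"
    using \<rho>n by (intro comp_inj_on strict_mono_on_imp_inj_on[OF \<rho>] inj_on_subset[OF \<sigma>(2)]) auto
  then obtain r where rR: "(3, r) \<in> R" and sm: "strict_mono_on {1..3} (\<sigma> \<circ> \<rho> \<circ> r)"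
    using B Br \<rho>_simps unfolding represents_def by (metis comp_apply)
  have r: "r permutes {1..3}" using R rR by blast
  have "\<sigma> r3 \<le> l r3" using \<sigma>(1) rows by (fastforce dest: PiE_mem)
  then have le3: "\<sigma> (\<rho> y) \<le> l r3" for y using le by (auto simp: \<rho>_def)
  have "((\<sigma> \<circ> \<rho> \<circ> r) x, \<rho> y) \<in> ?F \<and> (fill n l \<sigma> ((\<sigma> \<circ> \<rho> \<circ> r) x, \<rho> y) = 1 \<longleftrightarrow> r x = y)"
    if x: "x \<in> {1..3}" and y: "y \<in> {1..3}" for x y
  proof -
    have "l r3 \<le> l (\<rho> y)"
      using monotone_onD[OF anti, of "\<rho> y" r3] \<rho>n[of y] rows by simp
    moreover have "1 \<le> \<sigma> (\<rho> (r x))"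
      using \<sigma>(1) \<rho>n(1)[of "r x"] by (fastforce dest: PiE_mem)
    ultimately have cell: "((\<sigma> \<circ> \<rho> \<circ> r) x, \<rho> y) \<in> ?F"
      using \<rho>n(1)[of y] le3[of "r x"] by (simp add: row_board_def)
    have "r x \<in> {1..3}" using permutes_in_image[OF r] x by simp
    then have "\<sigma> (\<rho> y) = \<sigma> (\<rho> (r x)) \<longleftrightarrow> r x = y"
      using inj_onD[OF inj, of y "r x"] y by auto
    then show ?thesis using cell fill_eq_1_iff[OF cell] by simp
  qed
  then have "contains_pattern ?F (fill n l \<sigma>) (3, r)"
    unfolding contains_pattern_def using sm \<rho> by blast
  then show "\<exists>p\<in>R. contains_pattern ?F (fill n l \<sigma>) p" using rR by blast
qed

lemma card_avoiding_fillings: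
  assumes R: "\<And>k r. (k, r) \<in> R \<Longrightarrow> k = 3 \<and> r permutes {1..3}" and B: "represents B R"
    and anti: "antimono_on {1..n} l" and l: "\<forall>j\<in>{1..n}. 1 \<le> l j \<and> l j \<le> n"
  shows "card (avoiding_fillings (row_board n l) R) = card (placements B n l)"
proof -
  let ?S = "{\<sigma> \<in> (\<Pi>\<^sub>E j\<in>{1..n}. {1..l j}). inj_on \<sigma> {1..n}}"
  have bij: "bij_betw (fill n l) ?S (fillings (row_board n l))" by (rule bij_betw_fill[OF l])
  have eq: "placements B n l =
      {\<sigma> \<in> ?S. \<not> (\<exists>p\<in>R. contains_pattern (row_board n l) (fill n l \<sigma>) p)}"
    using fill_contains_iff[OF R B anti] unfolding placements_def by blast
  have "avoiding_fillings (row_board n l) R = fill n l ` placements B n l"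
    unfolding avoiding_fillings_def eq bij_betw_imp_surj_on[OF bij, symmetric] by blast
  moreover have "inj_on (fill n l) (placements B n l)"
    using bij_betw_imp_inj_on[OF bij] by (rule inj_on_subset) (auto simp: eq)
  ultimately show ?thesis by (simp add: card_image)
qed

lemma permutes_3_cases:
  fixes r :: "nat \<Rightarrow> nat"
  assumes "r permutes {1..3}"
  obtains "r 1 = 1" "r 2 = 2" "r 3 = 3" | "r 1 = 1" "r 2 = 3" "r 3 = 2"
    | "r 1 = 2" "r 2 = 1" "r 3 = 3" | "r 1 = 2" "r 2 = 3" "r 3 = 1"
    | "r 1 = 3" "r 2 = 1" "r 3 = 2" | "r 1 = 3" "r 2 = 2" "r 3 = 1"
proof -
  have "{1..3::nat} = {1, 2, 3}" by auto
  then have "r 1 \<in> {1, 2, 3}" "r 2 \<in> {1, 2, 3}" "r 3 \<in> {1, 2, 3}"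
    using permutes_in_image[OF assms] by auto
  moreover have "r 1 \<noteq> r 2" "r 2 \<noteq> r 3" "r 1 \<noteq> r 3"
    using permutes_inj[OF assms] by (simp_all add: inj_eq)
  ultimately show ?thesis using that unfolding insert_iff empty_iff by metis
qed

text \<open>Supplies the pattern formed by three 1s in distinct columns.\<close>

lemma ex_sorting_permutation_3:
  fixes x :: "nat \<Rightarrow> nat"
  assumes "inj_on x {1..3}"
  obtains r where "r permutes {1..3}" "strict_mono_on {1..3} (x \<circ> r)"
proof -
  have perm: "id(1 := u, 2 := v, 3 := w) permutes {1..3::nat}" if "{u, v, w} = {1, 2, 3}" for u v w
  proof (rule bij_imp_permutes)
    have three: "{1..3::nat} = {1, 2, 3}" by auto
    have "card {u, v, w} = 3" by (simp add: that)
    then have "u \<noteq> v" "v \<noteq> w" "u \<noteq> w" by (auto simp: card_insert_if split: if_splits)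
    then have "inj_on (id(1 := u, 2 := v, 3 := w)) {1, 2, 3}" by simp
    moreover have "id(1 := u, 2 := v, 3 := w) ` {1, 2, 3} = {u, v, w}" by simp
    ultimately show "bij_betw (id(1 := u, 2 := v, 3 := w)) {1..3} {1..3}"
      unfolding bij_betw_def three using that by simp
  qed auto
  have "x 1 \<noteq> x 2" "x 2 \<noteq> x 3" "x 1 \<noteq> x 3"
    using inj_on_eq_iff[OF assms] by simp_all
  then consider "x 1 < x 2 \<and> x 2 < x 3" | "x 1 < x 3 \<and> x 3 < x 2" | "x 2 < x 1 \<and> x 1 < x 3"
    | "x 2 < x 3 \<and> x 3 < x 1" | "x 3 < x 1 \<and> x 1 < x 2" | "x 3 < x 2 \<and> x 2 < x 1"
    by linarith
  then have "\<exists>u v w. {u, v, w} = {1, 2, 3} \<and> x u < x v \<and> x v < x w"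
    by cases (metis insert_commute)+
  then obtain u v w where uvw: "{u, v, w} = {1, 2, 3}" "x u < x v" "x v < x w" by blast
  then show thesis
    by (intro that[OF perm[OF uvw(1)]]) (simp add: strict_mono_on_3[simplified])
qed

text \<open>Some permutation sorts \<open>x\<close>, so it suffices to compare \<open>B\<close> with
  the poset condition on sorting permutations; this leaves six cases.\<close>

lemma represents_pop_patternsI:
  assumes "\<And>(x :: nat \<Rightarrow> nat) r. r permutes {1..3} \<Longrightarrow> strict_mono_on {1..3} (x \<circ> r) \<Longrightarrow>
    B (x 1) (x 2) (x 3) \<longleftrightarrow> (\<forall>j m. (j, m) \<in> P \<and> j \<noteq> m \<longrightarrow> r j < r m)"
  shows "represents B (pop_patterns 3 P)"
  unfolding represents_def
proof (intro allI impI iffI)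
  fix x :: "nat \<Rightarrow> nat" assume "inj_on x {1..3}" and b: "B (x 1) (x 2) (x 3)"
  then obtain r where "r permutes {1..3}" "strict_mono_on {1..3} (x \<circ> r)"
    using ex_sorting_permutation_3 by blast
  then show "\<exists>r. (3, r) \<in> pop_patterns 3 P \<and> strict_mono_on {1..3} (x \<circ> r)"
    using b assms[of r x] unfolding pop_patterns_def by blast
next
  fix x :: "nat \<Rightarrow> nat" assume "\<exists>r. (3, r) \<in> pop_patterns 3 P \<and> strict_mono_on {1..3} (x \<circ> r)"
  then show "B (x 1) (x 2) (x 3)" using assms unfolding pop_patterns_def by blast
qed

text \<open>The poset condition means \<open>r a = 3\<close>, that is, \<open>x 3\<close> is the
  \<open>a\<close>-th smallest of the three columns.\<close>

lemma represents_top_bad: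
  assumes a: "a \<in> {1, 2, 3}"
  shows "represents (top_bad a) (pop_patterns 3 (pop_top a))"
proof (rule represents_pop_patternsI)
  fix x r :: "nat \<Rightarrow> nat" assume r: "r permutes {1..3}" and "strict_mono_on {1..3} (x \<circ> r)"
  then have lt: "x (r 1) < x (r 2)" "x (r 2) < x (r 3)" using strict_mono_on_3[of "x \<circ> r"] by auto
  have "{1..3::nat} = {1, 2, 3}" by auto
  then have top: "(\<forall>j m. (j, m) \<in> pop_top a \<and> j \<noteq> m \<longrightarrow> r j < r m) \<longleftrightarrow>
      (\<forall>j\<in>{1, 2, 3}. j \<noteq> a \<longrightarrow> r j < r a)"
    by (auto simp: pop_top_def)
  consider "a = 1" | "a = 2" | "a = 3" using a by blast
  then show "top_bad a (x 1) (x 2) (x 3) \<longleftrightarrow> (\<forall>j m. (j, m) \<in> pop_top a \<and> j \<noteq> m \<longrightarrow> r j < r m)"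
  proof cases
    case 1
    then show ?thesis unfolding top using lt by - (rule permutes_3_cases[OF r]; simp add: top_bad_def)
  next
    case 2
    then show ?thesis unfolding top using lt by - (rule permutes_3_cases[OF r]; simp add: top_bad_def)
  next
    case 3
    then show ?thesis unfolding top using lt by - (rule permutes_3_cases[OF r]; simp add: top_bad_def)
  qed
qed

text \<open>The poset condition means \<open>r 2 = 1\<close>, that is, \<open>x 1\<close> is the
  middle one of the three columns.\<close>

lemma represents_V_bad: "represents V_bad (pop_patterns 3 pop_V)"
proof (rule represents_pop_patternsI)
  fix x r :: "nat \<Rightarrow> nat" assume r: "r permutes {1..3}" and "strict_mono_on {1..3} (x \<circ> r)"
  then have lt: "x (r 1) < x (r 2)" "x (r 2) < x (r 3)" using strict_mono_on_3[of "x \<circ> r"] by auto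
  have V: "(\<forall>j m. (j, m) \<in> pop_V \<and> j \<noteq> m \<longrightarrow> r j < r m) \<longleftrightarrow> r 2 < r 1 \<and> r 2 < r 3"
    by (auto simp: pop_V_def)
  show "V_bad (x 1) (x 2) (x 3) \<longleftrightarrow> (\<forall>j m. (j, m) \<in> pop_V \<and> j \<noteq> m \<longrightarrow> r j < r m)"
    unfolding V using lt by - (rule permutes_3_cases[OF r]; simp add: V_bad_def)
qed

section \<open>Equality of the counts on every Ferrers board\<close>

theorem theorem3p3:
  fixes a :: nat
  assumes "a \<in> {1, 2, 3}"
  shows "pop_shape_Wilf_equivalent 3 (pop_top a) 3 pop_V"
  unfolding pop_shape_Wilf_equivalent_def shape_Wilf_equivalent_def
proof (intro allI impI)
  fix F assume "ferrers_board F"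
  then obtain n l where F: "F = row_board n l" and anti: "antimono_on {1..n} l"
    and pos: "\<forall>j\<in>{1..n}. 1 \<le> l j"
    by (rule ferrers_board_rows)
  show "card (avoiding_fillings F (pop_patterns 3 (pop_top a))) =
      card (avoiding_fillings F (pop_patterns 3 pop_V))"
  \<comment> \<open>A board without fillings gives zero on both sides; any filling forces the row
    lengths to be at most \<open>n\<close>, as the recursion requires.\<close>
  proof (cases "fillings F = {}")
    case True
    then show ?thesis by (simp add: avoiding_fillings_def)
  next
    case False
    then have l: "\<forall>j\<in>{1..n}. 1 \<le> l j \<and> l j \<le> n"
      using pos fillings_row_le F by blast
    have R: "card (avoiding_fillings F (pop_patterns 3 P)) = card (placements B n l)"
      if "represents B (pop_patterns 3 P)" for B P
      unfolding F using that anti l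
      by (intro card_avoiding_fillings) (auto simp: pop_patterns_def)
    have "card (placements (top_bad a) n l) = card (placements V_bad n l)"
      using l by (intro card_placements_eq order_invariant_top_bad two_insertions_top_bad
        order_invariant_V_bad two_insertions_V_bad anti) blast
    then show ?thesis
      using R[OF represents_top_bad[OF assms]] R[OF represents_V_bad] by simp
  qed
qed

end
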